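(* Let $\Gamma$ be a connected graph, $v_0$ a cut-point in $\Gamma$, and $\mu$ a probability measure on $V(\Gamma)$ whose weight function $M$ is totally defined. If $v_1$ and $v_2$ belong to distinct connected components of $\Gamma\setminus\{v_0\}$, then the inequalities $M(v_0)\ge M(v_1)$ and $M(v_0)\ge M(v_2)$ cannot hold simultaneously.
   Context: Let $d$ be the graph distance on $V(\Gamma)$. A probability measure $\mu$ on $V(\Gamma)$ is atomic: $\mu:V(\Gamma)\to[0,1]$ with $\sum_{s}\mu(s)=1$. Its weight function is $M(v)=\sum_{s\in V(\Gamma)}d^2(v,s)\mu(s)$, totally defined if $M(v)<\infty$ for all $v$. A vertex $v_0$ is a cut-point of $\Gamma$ if removing $v_0$ from $\Gamma$ results in a disconnected graph. *)

theory Defs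
  imports
    "HOL-Probability.Probability"
    "Graph_Theory.Graph_Theory"
begin

text \<open>
  Undirected graphs are modelled, as in Graph\_Theory, by symmetric digraphs
  (locale \<open>sym_digraph\<close>). There is no finiteness assumption, and loops and parallel
  edges are permitted.
\<close>

text \<open>
  The graph distance is the infimum of the costs of all walks when every arc has weight 1;
  it is infinite exactly between vertices not joined by a walk.
\<close>

definition graph_dist :: "('a, 'b) pre_digraph \<Rightarrow> 'a \<Rightarrow> 'a \<Rightarrow> ennreal" where
  "graph_dist G u v = e2ennreal (wf_digraph.\<mu> G (\<lambda>_. 1) u v)"

text \<open>
  A probability measure on the vertex set is a \<open>pmf\<close> on the vertex type whose support lies
  in \<open>verts G\<close>. The sum takes values in \<open>[0, \<infinity>]\<close>, where it always exists.
\<close>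

definition weight_fn :: "('a, 'b) pre_digraph \<Rightarrow> 'a pmf \<Rightarrow> 'a \<Rightarrow> ennreal" where
  "weight_fn G \<mu> v = (\<Sum>\<^sub>\<infinity>s\<in>verts G. (graph_dist G v s)\<^sup>2 * ennreal (pmf \<mu> s))"

definition totally_defined :: "('a, 'b) pre_digraph \<Rightarrow> 'a pmf \<Rightarrow> bool" where
  "totally_defined G \<mu> \<longleftrightarrow> (\<forall>v\<in>verts G. weight_fn G \<mu> v < \<infinity>)"

text \<open>
  The qualified name \<open>Digraph_Component.connected\<close> avoids topological connectedness.
  It regards the null graph as not connected, so the vertex of a one-vertex graph counts as a
  cut-point; its deletion leaves no components.
\<close>

definition cut_point :: "('a, 'b) pre_digraph \<Rightarrow> 'a \<Rightarrow> bool" where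
  "cut_point G v \<longleftrightarrow> v \<in> verts G \<and> \<not> Digraph_Component.connected (pre_digraph.del_vert G v)"

definition graph_components :: "('a, 'b) pre_digraph \<Rightarrow> ('a, 'b) pre_digraph set" where
  "graph_components G = {C. pre_digraph.max_subgraph G Digraph_Component.connected C}"

end

theory Submission
  imports Defs
begin

text \<open>
  Let \<open>d\<close> be the graph distance, \<open>a = d(v1, v0)\<close>, \<open>b = d(v2, v0)\<close>, and consider a vertex \<open>s\<close>
  with \<open>x = d(v0, s)\<close>. As \<open>v1\<close> and \<open>v2\<close> lie in different components of the graph without \<open>v0\<close>,
  the vertex \<open>s\<close> is cut off by \<open>v0\<close> from at least one of them, say from \<open>v2\<close>. Every walk from
  \<open>v2\<close> to \<open>s\<close> then visits \<open>v0\<close>, so \<open>d(v2, s) = x + b\<close> exactly (\<open>graph_dist_through\<close>), while the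
  triangle inequality gives \<open>d(v1, s) \<ge> \<bar>x - a\<bar>\<close>. It is as if \<open>v1\<close>, \<open>v0\<close>, \<open>v2\<close>
  were the points \<open>-a\<close>, \<open>0\<close>, \<open>b\<close> of a line: the squared distance to \<open>s\<close> is strictly convex along
  it. Combining the two bounds with the weights \<open>b\<close> and \<open>a\<close> that make \<open>v0\<close> the barycentre of
  \<open>v1\<close> and \<open>v2\<close>, the terms linear in \<open>x\<close> cancel and
  \<open>b d(v1, s)\<^sup>2 + a d(v2, s)\<^sup>2 \<ge> (a + b) x\<^sup>2 + a b (a + b)\<close>.
  This is \<open>graph_dist_weighted_square_ineq\<close>; it is symmetric under exchanging \<open>v1\<close> with \<open>v2\<close>, so it
  holds for every \<open>s\<close>. Summing against a probability measure yields
  \<open>b M(v1) + a M(v2) \<ge> (a + b) M(v0) + a b (a + b)\<close> (\<open>weight_fn_separated_ineq\<close>). Since \<open>a\<close> and \<open>b\<close>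
  are positive and \<open>M(v0)\<close> is finite, \<open>M(v1)\<close> and \<open>M(v2)\<close> cannot both be at most \<open>M(v0)\<close>.
\<close>

section \<open>Graph distance\<close>

lemma (in wf_digraph) awalk_cost_unit: "awalk_cost (\<lambda>_. 1) p = real (length p)"
  by (induct p) auto

lemma (in wf_digraph) graph_dist_le:
  assumes "awalk u p v"
  shows "graph_dist G u v \<le> ennreal (real (length p))"
proof -
  have "\<mu> (\<lambda>_. 1) u v \<le> ereal (real (length p))"
    using min_cost_le_walk_cost[OF assms, of "\<lambda>_. 1"] by (simp add: awalk_cost_unit)
  from e2ennreal_mono[OF this] show ?thesis by (simp add: graph_dist_def)
qed

text \<open>
  Walk lengths are natural numbers, so the infimum defining the distance is attained. All
  properties of the distance below are read off from walks realising it.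
\<close>
lemma (in wf_digraph) shortest_awalk:
  assumes "u \<rightarrow>\<^sup>* v"
  obtains p where "awalk u p v" "graph_dist G u v = ennreal (real (length p))"
proof -
  obtain p0 where "awalk u p0 v" using assms by (auto simp: reachable_awalk)
  then obtain p where p: "awalk u p v" "\<And>q. awalk u q v \<Longrightarrow> length p \<le> length q"
    using ex_has_least_nat[of "\<lambda>p. awalk u p v" p0 length] by blast
  have "\<mu> (\<lambda>_. 1) u v = ereal (real (length p))"
    unfolding \<mu>_def awalk_cost_unit
    using p by (intro antisym INF_greatest) (auto intro: INF_lower2)
  with p(1) show thesis by (intro that) (simp_all add: graph_dist_def)
qed

lemma (in wf_digraph) graph_dist_triangle:
  assumes "u \<rightarrow>\<^sup>* w" "w \<rightarrow>\<^sup>* v"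
  shows "graph_dist G u v \<le> graph_dist G u w + graph_dist G w v"
proof -
  obtain p where p: "awalk u p w" "graph_dist G u w = ennreal (real (length p))"
    using shortest_awalk[OF assms(1)] .
  obtain q where q: "awalk w q v" "graph_dist G w v = ennreal (real (length q))"
    using shortest_awalk[OF assms(2)] .
  have "awalk u (p @ q) v" using p(1) q(1) by (rule awalk_appendI)
  from graph_dist_le[OF this] show ?thesis using p(2) q(2) by simp
qed

text \<open>
  The triangle inequality is an equality at an unavoidable vertex: a shortest walk from \<open>u\<close> to \<open>v\<close>
  splits at \<open>w\<close> into two walks, which are at least as long as the distances of their ends.
\<close>
lemma (in wf_digraph) graph_dist_through:
  assumes "u \<rightarrow>\<^sup>* v" and thr: "\<And>p. awalk u p v \<Longrightarrow> w \<in> set (awalk_verts u p)"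
  shows "graph_dist G u v = graph_dist G u w + graph_dist G w v"
proof (rule antisym)
  obtain p where p: "awalk u p v" "graph_dist G u v = ennreal (real (length p))"
    using shortest_awalk[OF assms(1)] .
  obtain q r where qr: "p = q @ r" "awalk u q w" "awalk w r v"
    using awalk_decomp[OF p(1) thr[OF p(1)]] by blast
  have "graph_dist G u w + graph_dist G w v \<le> ennreal (real (length q)) + ennreal (real (length r))"
    using qr by (intro add_mono graph_dist_le)
  then show "graph_dist G u w + graph_dist G w v \<le> graph_dist G u v"
    using p(2) qr(1) by simp
  show "graph_dist G u v \<le> graph_dist G u w + graph_dist G w v"
    using qr(2,3) by (intro graph_dist_triangle) (auto simp: reachable_awalk)
qed

lemma (in sym_digraph) awalk_reverse:
  assumes "awalk u p v"
  obtains q where "awalk v q u" "length q = length p"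
proof -
  have "\<exists>q. awalk v q u \<and> length q = length p" using assms
  proof (induct p arbitrary: u)
    case Nil then show ?case by (auto simp: awalk_Nil_iff intro: exI[of _ "[]"])
  next
    case (Cons e p)
    then have e: "e \<in> arcs G" "u = tail G e" "awalk (head G e) p v"
      by (auto simp: awalk_Cons_iff)
    from Cons(1)[OF e(3)] obtain q where q: "awalk v q (head G e)" "length q = length p" by blast
    obtain e' where e': "e' \<in> arcs G" "tail G e = head G e'" "head G e = tail G e'"
      using sym_arcs e(1) unfolding symmetric_conv by blast
    have "awalk v (q @ [e']) u"
      using q(1) arc_implies_awalk[OF e'(1)] e'(2,3) e(2) by (auto intro: awalk_appendI)
    then show ?case using q(2) by (intro exI[of _ "q @ [e']"]) auto
  qed
  then show thesis using that by blast
qed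

lemma (in sym_digraph) graph_dist_commute:
  assumes "u \<rightarrow>\<^sup>* v"
  shows "graph_dist G u v = graph_dist G v u"
proof -
  have le: "graph_dist G y x \<le> graph_dist G x y" if xy: "x \<rightarrow>\<^sup>* y" for x y
  proof -
    obtain p where p: "awalk x p y" "graph_dist G x y = ennreal (real (length p))"
      using shortest_awalk[OF xy] .
    obtain q where "awalk y q x" "length q = length p" using awalk_reverse[OF p(1)] .
    then show ?thesis using graph_dist_le p(2) by metis
  qed
  show ?thesis using le[OF assms] le[OF symmetric_reachable'[OF assms]] by (rule antisym[rotated])
qed

section \<open>Components of a vertex-deleted graph\<close>

lemma (in wf_digraph) awalk_del_vert:
  assumes "awalk u p v" "w \<notin> set (awalk_verts u p)"
  shows "u \<rightarrow>\<^sup>*\<^bsub>del_vert w\<^esub> v"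
proof -
  interpret D: wf_digraph "del_vert w" by (rule wf_digraph_del_vert)
  have "set p \<subseteq> arcs (del_vert w)"
    using assms by (auto simp: del_vert_simps set_awalk_verts awalk_def)
  moreover have "u \<in> verts (del_vert w)"
    using assms hd_in_awalk_verts(1)[OF assms(1)] by (auto simp: del_vert_simps awalk_def)
  moreover have "D.cas u p v"
    using assms compatible_cas[of G "del_vert w"]
    by (auto simp: awalk_def compatible_def del_vert_simps)
  ultimately have "D.awalk u p v" by (simp add: D.awalk_def)
  then show ?thesis by (auto simp: D.reachable_awalk)
qed

lemma (in sym_digraph) sym_digraph_del_vert: "sym_digraph (del_vert w)"
proof (rule wf_digraph.sym_digraphI[OF wf_digraph_del_vert])
  show "symmetric (del_vert w)"
    using sym_arcs unfolding symmetric_conv by (fastforce simp: del_vert_simps)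
qed

lemma strongly_connected_imp_connected:
  assumes "strongly_connected H"
  shows "Digraph_Component.connected H"
proof -
  have "arcs_ends H \<subseteq> parcs (mk_symmetric H)" by (auto simp: parcs_mk_symmetric arcs_ends_conv)
  then show ?thesis using assms
    unfolding Digraph_Component.connected_def strongly_connected_def
    by (auto simp: reachable_def intro: rtrancl_on_mono)
qed

lemma arc_mono_connected: "arc_mono Digraph_Component.connected"
  unfolding arc_mono_def
proof (intro allI impI, elim conjE)
  fix H1 H2 :: "('a, 'b) pre_digraph"
  assume H: "Digraph_Component.connected H1" "subgraph H1 H2" "verts H1 = verts H2"
  then have "spanning H1 H2" by (simp add: spanning_def)
  moreover have "wf_digraph H2" using H(2) by auto
  ultimately show "Digraph_Component.connected H2"
    using H(1) by (auto intro: wf_digraph.connected_spanning_imp_connected)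
qed

text \<open>
  Graph components are maximal connected subgraphs, whereas the disjointness of components is
  known for the maximal strongly connected subgraphs \<open>sccs\<close>. In a symmetric digraph every induced
  subgraph is symmetric, hence strongly connected as soon as it is connected; a maximal connected
  subgraph is induced because adding arcs preserves connectedness.
\<close>
lemma (in sym_digraph) graph_components_subset_sccs: "graph_components G \<subseteq> sccs"
proof
  fix C assume "C \<in> graph_components G"
  then have C: "max_subgraph Digraph_Component.connected C" by (simp add: graph_components_def)
  have ind: "induced_subgraph C G" using C arc_mono_connected by (rule induced_subgraphI_arc_mono)
  have "strongly_connected C"
    using wf_digraphI_induced[OF ind] induced_graph_imp_symmetric[OF sym_arcs ind]
      max_subgraph_prop[OF C]
    by (rule wf_digraph.symmetric_connected_imp_strongly_connected)
  then have "max_subgraph strongly_connected C"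
    by (intro max_subgraph_mp[OF C] strongly_connected_imp_connected)
  then show "C \<in> sccs" by (simp add: sccs_altdef2)
qed

lemma (in sym_digraph) graph_components_reachable_eq:
  assumes C: "C1 \<in> graph_components G" "C2 \<in> graph_components G"
    and v: "v1 \<in> verts C1" "v2 \<in> verts C2" and "v1 \<rightarrow>\<^sup>* v2"
  shows "C1 = C2"
proof -
  have sccs: "C1 \<in> sccs" "C2 \<in> sccs" using C graph_components_subset_sccs by auto
  have sv: "verts C1 \<in> sccs_verts" "verts C2 \<in> sccs_verts"
    using sccs by (auto simp: sccs_verts_conv)
  have "v2 \<in> verts C1"
    using sv(1) v(1) assms(5) symmetric_reachable'[OF assms(5)]
    unfolding in_sccs_verts_conv_reachable by blast
  then have "verts C1 = verts C2" using sccs_verts_disjoint[OF sv] v(2) by blast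
  then show ?thesis using sccs by (intro in_sccs_subset_imp_eq) auto
qed

section \<open>Infinite sums of extended nonnegative reals\<close>

lemma infsum_cmult_right_ennreal:
  fixes f :: "'a \<Rightarrow> ennreal"
  shows "(\<Sum>\<^sub>\<infinity>x\<in>A. c * f x) = c * (\<Sum>\<^sub>\<infinity>x\<in>A. f x)"
  by (simp add: nonneg_infsum_complete SUP_mult_left_ennreal flip: sum_distrib_left)

lemma infsum_add_ennreal:
  fixes f g :: "'a \<Rightarrow> ennreal"
  shows "(\<Sum>\<^sub>\<infinity>x\<in>A. f x + g x) = (\<Sum>\<^sub>\<infinity>x\<in>A. f x) + (\<Sum>\<^sub>\<infinity>x\<in>A. g x)"
  by (intro infsum_add nonneg_summable_on_complete) auto

text \<open>
  The sum is in fact the total mass \<open>1\<close>; its positivity is what makes the gap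
  \<open>a b (a + b)\<close> survive the summation.
\<close>
lemma infsum_pmf_pos:
  assumes "set_pmf p \<subseteq> A"
  shows "(\<Sum>\<^sub>\<infinity>s\<in>A. ennreal (pmf p s)) > 0"
proof -
  obtain s where s: "s \<in> set_pmf p" using set_pmf_not_empty[of p] by blast
  have "0 < ennreal (pmf p s)" using s by (simp add: pmf_positive)
  also have "\<dots> \<le> (\<Sum>\<^sub>\<infinity>s\<in>A. ennreal (pmf p s))"
    using s assms by (auto simp: nonneg_infsum_complete intro!: SUP_upper2[of "{s}"])
  finally show ?thesis .
qed

section \<open>Weights of vertices separated by a cut-point\<close>

text \<open>
  With \<open>y = \<bar>x - a\<bar>\<close> this is an identity: the mixed terms \<open>- 2 a b x\<close> and \<open>2 a b x\<close> cancel.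
\<close>
lemma weighted_square_ineq:
  fixes a b x y z :: real
  assumes "a \<ge> 0" "b \<ge> 0" "\<bar>x - a\<bar> \<le> y" "z = x + b"
  shows "(a + b) * x\<^sup>2 + a * b * (a + b) \<le> b * y\<^sup>2 + a * z\<^sup>2"
proof -
  have "(x - a)\<^sup>2 \<le> y\<^sup>2" using assms(3) by (metis abs_ge_zero power2_abs power_mono)
  then have "b * (x - a)\<^sup>2 \<le> b * y\<^sup>2" using assms(2) by (rule mult_left_mono)
  then show ?thesis unfolding assms(4) by (simp add: power2_eq_square algebra_simps)
qed

text \<open>
  The bound \<open>\<bar>x - a\<bar> \<le> y\<close> consists of the triangle inequalities for \<open>v0, v1, s\<close> and for
  \<open>v1, s, v0\<close>; both use the symmetry of the distance. As all distances are finite, the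
  inequality can be checked over the reals, where the square of a difference makes sense.
\<close>
lemma (in sym_digraph) graph_dist_weighted_square_ineq:
  assumes conn: "strongly_connected G" and V: "v0 \<in> verts G" "v1 \<in> verts G" "v2 \<in> verts G" "s \<in> verts G"
    and thr: "\<And>p. awalk v2 p s \<Longrightarrow> v0 \<in> set (awalk_verts v2 p)"
  defines "a \<equiv> graph_dist G v1 v0" and "b \<equiv> graph_dist G v2 v0"
  shows "(a + b) * (graph_dist G v0 s)\<^sup>2 + a * b * (a + b)
    \<le> b * (graph_dist G v1 s)\<^sup>2 + a * (graph_dist G v2 s)\<^sup>2"
proof -
  have reach: "u \<rightarrow>\<^sup>* v" if "u \<in> verts G" "v \<in> verts G" for u v
    using conn that by (auto simp: strongly_connected_def)
  have fin: "\<exists>r\<ge>0. graph_dist G u v = ennreal r" if "u \<in> verts G" "v \<in> verts G" for u v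
    using shortest_awalk[OF reach[OF that]] of_nat_0_le_iff by metis
  obtain ra rb x y z where r: "ra \<ge> 0" "a = ennreal ra" "rb \<ge> 0" "b = ennreal rb"
    "x \<ge> 0" "graph_dist G v0 s = ennreal x" "y \<ge> 0" "graph_dist G v1 s = ennreal y"
    "z \<ge> 0" "graph_dist G v2 s = ennreal z"
    using fin V unfolding a_def b_def by metis
  have "ennreal x \<le> ennreal (ra + y)"
    using graph_dist_triangle[of v0 v1 s] graph_dist_commute[of v0 v1] reach V r
    by (simp add: a_def)
  then have 1: "x \<le> ra + y" using r by (subst (asm) ennreal_le_iff) auto
  have "ennreal ra \<le> ennreal (y + x)"
    using graph_dist_triangle[of v1 s v0] graph_dist_commute[of s v0] reach V r
    by (simp add: a_def)
  then have 2: "ra \<le> y + x" using r by (subst (asm) ennreal_le_iff) auto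
  have "ennreal z = ennreal (rb + x)"
    using graph_dist_through[OF reach[OF V(3,4)] thr] r
    by (simp add: b_def)
  then have 3: "z = x + rb" using r by (subst (asm) ennreal_inj) auto
  have "(ra + rb) * x\<^sup>2 + ra * rb * (ra + rb) \<le> rb * y\<^sup>2 + ra * z\<^sup>2"
    using 1 2 3 r by (intro weighted_square_ineq) auto
  then have "ennreal ((ra + rb) * x\<^sup>2 + ra * rb * (ra + rb)) \<le> ennreal (rb * y\<^sup>2 + ra * z\<^sup>2)"
    by (rule ennreal_leI)
  then show ?thesis using r by (simp add: ennreal_mult ennreal_power)
qed

text \<open>
  The sum over \<open>s\<close> of the pointwise inequality, which holds whichever of \<open>v1\<close> and \<open>v2\<close> is cut off
  from \<open>s\<close>. If both are joined to \<open>s\<close> without \<open>v0\<close>, they are joined to each other.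
\<close>
lemma (in sym_digraph) weight_fn_separated_ineq:
  assumes conn: "strongly_connected G" and V: "v0 \<in> verts G" "v1 \<in> verts G" "v2 \<in> verts G"
    and sep: "\<not> v1 \<rightarrow>\<^sup>*\<^bsub>del_vert v0\<^esub> v2"
  defines "a \<equiv> graph_dist G v1 v0" and "b \<equiv> graph_dist G v2 v0"
  shows "(a + b) * weight_fn G p v0 + a * b * (a + b) * (\<Sum>\<^sub>\<infinity>s\<in>verts G. ennreal (pmf p s))
    \<le> b * weight_fn G p v1 + a * weight_fn G p v2"
proof -
  interpret D: sym_digraph "del_vert v0" by (rule sym_digraph_del_vert)
  have pointwise: "(a + b) * (graph_dist G v0 s)\<^sup>2 + a * b * (a + b)
    \<le> b * (graph_dist G v1 s)\<^sup>2 + a * (graph_dist G v2 s)\<^sup>2" if s: "s \<in> verts G" for s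
  proof (cases "\<forall>q. awalk v2 q s \<longrightarrow> v0 \<in> set (awalk_verts v2 q)")
    case True
    then show ?thesis unfolding a_def b_def
      using conn V s by (intro graph_dist_weighted_square_ineq) auto
  next
    case False
    then obtain q where "awalk v2 q s" "v0 \<notin> set (awalk_verts v2 q)" by blast
    then have "s \<rightarrow>\<^sup>*\<^bsub>del_vert v0\<^esub> v2" using D.symmetric_reachable'[OF awalk_del_vert] by blast
    \<comment> \<open>A walk from \<open>v1\<close> to \<open>s\<close> avoiding \<open>v0\<close> would now join \<open>v1\<close> to \<open>v2\<close> without \<open>v0\<close>, so the
      roles of \<open>v1\<close> and \<open>v2\<close> are exchanged.\<close>
    then have "v0 \<in> set (awalk_verts v1 q)" if "awalk v1 q s" for q
      using sep that awalk_del_vert D.reachable_trans by blast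
    then show ?thesis unfolding a_def b_def
      using graph_dist_weighted_square_ineq[OF conn V(1,3,2) s]
      by (simp add: ac_simps)
  qed
  have "(a + b) * weight_fn G p v0 + a * b * (a + b) * (\<Sum>\<^sub>\<infinity>s\<in>verts G. ennreal (pmf p s))
    = (\<Sum>\<^sub>\<infinity>s\<in>verts G. ((a + b) * (graph_dist G v0 s)\<^sup>2 + a * b * (a + b)) * ennreal (pmf p s))"
    unfolding weight_fn_def
    by (simp add: distrib_right mult.assoc infsum_add_ennreal flip: infsum_cmult_right_ennreal)
  also have "\<dots> \<le> (\<Sum>\<^sub>\<infinity>s\<in>verts G.
      (b * (graph_dist G v1 s)\<^sup>2 + a * (graph_dist G v2 s)\<^sup>2) * ennreal (pmf p s))"
    by (intro infsum_mono nonneg_summable_on_complete mult_right_mono pointwise) auto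
  also have "\<dots> = b * weight_fn G p v1 + a * weight_fn G p v2"
    unfolding weight_fn_def
    by (simp add: distrib_right mult.assoc infsum_add_ennreal flip: infsum_cmult_right_ennreal)
  finally show ?thesis .
qed

theorem corollary5p4:
  fixes G :: "('a, 'b) pre_digraph" and \<mu> :: "'a pmf" and v0 v1 v2 :: 'a
    and C1 C2 :: "('a, 'b) pre_digraph"
  assumes "sym_digraph G"
    and "Digraph_Component.connected G"
    and "cut_point G v0"
    and "set_pmf \<mu> \<subseteq> verts G"
    and "totally_defined G \<mu>"
    and "C1 \<in> graph_components (pre_digraph.del_vert G v0)"
    and "C2 \<in> graph_components (pre_digraph.del_vert G v0)"
    and "C1 \<noteq> C2"
    and "v1 \<in> verts C1"
    and "v2 \<in> verts C2"
  shows "\<not> (weight_fn G \<mu> v0 \<ge> weight_fn G \<mu> v1 \<and> weight_fn G \<mu> v0 \<ge> weight_fn G \<mu> v2)"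
proof
  assume le: "weight_fn G \<mu> v0 \<ge> weight_fn G \<mu> v1 \<and> weight_fn G \<mu> v0 \<ge> weight_fn G \<mu> v2"
  interpret sym_digraph G by fact
  interpret D: sym_digraph "del_vert v0" by (rule sym_digraph_del_vert)
  have conn: "strongly_connected G"
    using sym_arcs assms(2) by (rule symmetric_connected_imp_strongly_connected)
  have v0: "v0 \<in> verts G" using assms(3) by (simp add: cut_point_def)
  have "verts C1 \<subseteq> verts G - {v0}" "verts C2 \<subseteq> verts G - {v0}"
    using assms(6,7) by (auto simp: graph_components_def pre_digraph.max_subgraph_def
        del_vert_simps dest!: subgraph_imp_subverts)
  then have v12: "v1 \<in> verts G" "v1 \<noteq> v0" "v2 \<in> verts G" "v2 \<noteq> v0" using assms(9,10) by auto
  have sep: "\<not> v1 \<rightarrow>\<^sup>*\<^bsub>del_vert v0\<^esub> v2"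
    using D.graph_components_reachable_eq[OF assms(6,7,9,10)] assms(8) by blast
  have pos: "0 < graph_dist G u v0 \<and> graph_dist G u v0 < \<infinity>" if u: "u \<in> verts G" "u \<noteq> v0" for u
  proof -
    have "u \<rightarrow>\<^sup>*\<^bsub>G\<^esub> v0" using conn u(1) v0 by (auto simp: strongly_connected_def)
    then obtain p where p: "awalk u p v0" "graph_dist G u v0 = ennreal (real (length p))"
      by (rule shortest_awalk)
    then have "p \<noteq> []" using u(2) by (auto simp: awalk_Nil_iff)
    then show ?thesis using p(2) by simp
  qed
  define a b where "a = graph_dist G v1 v0" and "b = graph_dist G v2 v0"
  define m where "m = (\<Sum>\<^sub>\<infinity>s\<in>verts G. ennreal (pmf \<mu> s))"
  have ab: "0 < a" "a < \<infinity>" "0 < b" "b < \<infinity>" using pos v12 by (auto simp: a_def b_def)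
  let ?M = "weight_fn G \<mu>"
  have "(a + b) * ?M v0 + a * b * (a + b) * m \<le> b * ?M v1 + a * ?M v2"
    unfolding a_def b_def m_def using conn v0 v12(1,3) sep by (rule weight_fn_separated_ineq)
  also have "\<dots> \<le> b * ?M v0 + a * ?M v0"
    using le by (intro add_mono mult_left_mono) auto
  also have "\<dots> = (a + b) * ?M v0 + 0" by (simp add: distrib_right add.commute)
  finally have "(a + b) * ?M v0 = \<infinity> \<or> a * b * (a + b) * m \<le> 0"
    by (subst (asm) ennreal_add_left_cancel_le) simp
  moreover have "(a + b) * ?M v0 < \<infinity>"
    using ab v0 assms(5) by (auto simp: totally_defined_def ennreal_mult_less_top)
  ultimately have "a * b * (a + b) * m = 0" by auto
  moreover have "m > 0" unfolding m_def using assms(4) by (rule infsum_pmf_pos)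
  ultimately show False using ab by auto
qed

end
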